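(* Let $\Gamma$, $D$ and the vector space $\Lambda\subseteq V^{\otimes3}$ be as described in the context. Then $\Lambda$ has dimension $\binom{D+3}{3}$.
   Context: GRAPH SETTING. $\Gamma=(X,\mathcal R)$ is a finite undirected connected graph without loops or multiple edges, with vertex set $X$, $|X|\ge 2$, path-length distance $\partial$ and diameter $D=\max\{\partial(x,y)\mid x,y\in X\}$. Write $\Gamma_i(x)=\{y\in X\mid\partial(x,y)=i\}$. $\Gamma$ is distance-regular: for $0\le h,i,j\le D$ and $\partial(x,y)=h$, the number $p^h_{i,j}=|\Gamma_i(x)\cap\Gamma_j(y)|$ depends only on $h,i,j$. Put $a_i=p^i_{1,i}$, $k_i=p^0_{i,i}$. $V$ is the complex vector space with basis $X$. For $0\le i\le D$, $A_i\in\mathrm{End}(V)$ sends $x\mapsto\sum_{\xi\in\Gamma_i(x)}\xi$. The $A_i$ form a basis of a commutative algebra $M\subseteq\mathrm{End}(V)$. The primitive idempotents $E_0,\dots,E_D$ are the basis of $M$ with $E_iE_j=\delta_{i,j}E_i$, $\sum_iE_i=I$, $E_0=|X|^{-1}\sum_iA_i$. The Krein parameters $q^h_{i,j}$ are given by $E_i\circ E_j=|X|^{-1}\sum_hq^h_{i,j}E_h$, where $\circ$ is the entrywise product of matrices with respect to the basis $X$. The ordering $E_0,\dots,E_D$ is $Q$-polynomial if for all $0\le h,i,j\le D$: $q^h_{i,j}=0$ when one of $h,i,j$ exceeds the sum of the other two, and $q^h_{i,j}\ne0$ when one of them equals the sum of the other two; $\Gamma$ is $Q$-polynomial if such an ordering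 exists. $\Gamma$ is bipartite if $a_i=0$ for all $i$; a bipartite $\Gamma$ is called 2-homogeneous if $k_D=1$ (antipodal 2-cover) and $\Gamma$ is $Q$-polynomial. ASSUMPTION. $D\ge3$, $\Gamma$ is 2-homogeneous bipartite, and $\Gamma$ is not a hypercube and not a cycle. THE SPACE $\Lambda$. $V^{\otimes3}=V\otimes V\otimes V$. $\mathcal P_D$ is the set of $(r,s,t,u)\in\mathbb N^4$ ($0\in\mathbb N$) with $r+s+t+u=D$. Every $x,y,z\in X$ have a unique profile $(r,s,t,u)\in\mathcal P_D$, determined by $\partial(x,y)=s+t$, $\partial(y,z)=t+u$, $\partial(z,x)=u+s$. For $(r,s,t,u)\in\mathcal P_D$, $B(r,s,t,u)=\sum x\otimes y\otimes z$ over all triples $x,y,z\in X$ of profile $(r,s,t,u)$. $\Lambda$ is the subspace of $V^{\otimes3}$ spanned by the vectors $B(r,s,t,u)$, $(r,s,t,u)\in\mathcal P_D$ (which form a basis of it). *)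

theory Defs
  imports "HOL-Analysis.Analysis"
begin

text \<open>
  A graph is given by its adjacency relation on a finite type of vertices.
\<close>

definition simple_connected_graph :: "('v::finite \<Rightarrow> 'v \<Rightarrow> bool) \<Rightarrow> bool" where
  "simple_connected_graph adj \<longleftrightarrow>
     CARD('v) \<ge> 2 \<and> symp adj \<and> irreflp adj \<and> (\<forall>x y. adj\<^sup>*\<^sup>* x y)"

definition gdist :: "('v::finite \<Rightarrow> 'v \<Rightarrow> bool) \<Rightarrow> 'v \<Rightarrow> 'v \<Rightarrow> nat" where
  "gdist adj x y = (LEAST n. (adj ^^ n) x y)"

definition diam :: "('v::finite \<Rightarrow> 'v \<Rightarrow> bool) \<Rightarrow> nat" where
  "diam adj = Max {gdist adj x y | x y. True}"

definition sphere_at :: "('v::finite \<Rightarrow> 'v \<Rightarrow> bool) \<Rightarrow> nat \<Rightarrow> 'v \<Rightarrow> 'v set" where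
  "sphere_at adj i x = {y. gdist adj x y = i}"

definition distance_regular :: "('v::finite \<Rightarrow> 'v \<Rightarrow> bool) \<Rightarrow> bool" where
  "distance_regular adj \<longleftrightarrow>
     simple_connected_graph adj \<and>
     (\<forall>h\<le>diam adj. \<forall>i\<le>diam adj. \<forall>j\<le>diam adj. \<exists>n. \<forall>x y. gdist adj x y = h \<longrightarrow>
        card (sphere_at adj i x \<inter> sphere_at adj j y) = n)"

text \<open>
  For a distance-regular graph and \<open>h, i, j \<le> diam adj\<close> this is the intersection number
  $p^h_{i,j}$; it is only meaningful in that case.
\<close>

definition intersection_number ::
    "('v::finite \<Rightarrow> 'v \<Rightarrow> bool) \<Rightarrow> nat \<Rightarrow> nat \<Rightarrow> nat \<Rightarrow> nat" where
  "intersection_number adj h i j =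
     (THE n. \<forall>x y. gdist adj x y = h \<longrightarrow>
        card (sphere_at adj i x \<inter> sphere_at adj j y) = n)"

definition bipartite :: "('v::finite \<Rightarrow> 'v \<Rightarrow> bool) \<Rightarrow> bool" where
  "bipartite adj \<longleftrightarrow> (\<forall>i\<le>diam adj. intersection_number adj i 1 i = 0)"

definition antipodal_2_cover :: "('v::finite \<Rightarrow> 'v \<Rightarrow> bool) \<Rightarrow> bool" where
  "antipodal_2_cover adj \<longleftrightarrow> intersection_number adj 0 (diam adj) (diam adj) = 1"


text \<open>
  The space $V$ is \<open>complex ^ 'v\<close>, a vertex \<open>x\<close> being the basis vector \<open>axis x 1\<close>, and
  endomorphisms of $V$ are identified with their matrices in this basis. The library has the
  complex scalar multiplication \<open>(*s)\<close> on vectors but none on matrices.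
\<close>

definition mscale :: "complex \<Rightarrow> complex^'n^'m \<Rightarrow> complex^'n^'m" (infixr "*m" 75) where
  "c *m A = map_matrix ((*) c) A"

global_interpretation cmat: vector_space "mscale :: complex \<Rightarrow> complex^'n^'m \<Rightarrow> complex^'n^'m"
  by unfold_locales (simp_all add: mscale_def vec_eq_iff algebra_simps)

definition distance_matrix :: "('v::finite \<Rightarrow> 'v \<Rightarrow> bool) \<Rightarrow> nat \<Rightarrow> complex^'v^'v" where
  "distance_matrix adj i = (\<chi> y x. if y \<in> sphere_at adj i x then 1 else 0)"

definition bose_mesner :: "('v::finite \<Rightarrow> 'v \<Rightarrow> bool) \<Rightarrow> (complex^'v^'v) set" where
  "bose_mesner adj = cmat.span (distance_matrix adj ` {..diam adj})"

definition primitive_idempotents ::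
    "('v::finite \<Rightarrow> 'v \<Rightarrow> bool) \<Rightarrow> (nat \<Rightarrow> complex^'v^'v) \<Rightarrow> bool" where
  "primitive_idempotents adj E \<longleftrightarrow>
     inj_on E {..diam adj} \<and>
     cmat.independent (E ` {..diam adj}) \<and>
     cmat.span (E ` {..diam adj}) = bose_mesner adj \<and>
     (\<forall>i\<le>diam adj. \<forall>j\<le>diam adj. E i ** E j = (if i = j then E i else 0)) \<and>
     (\<Sum>i\<le>diam adj. E i) = mat 1 \<and>
     E 0 = (1 / of_nat CARD('v)) *m (\<Sum>i\<le>diam adj. distance_matrix adj i)"

text \<open>
  Here \<open>q h i j\<close> stands for $q^h_{i,j}$. The product \<open>*\<close> on \<open>complex^'v^'v\<close> is the entrywise one
  (the matrix product is \<open>**\<close>). As the matrices \<open>E h\<close> are linearly independent, the values of \<open>q\<close>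
  on indices up to the diameter are uniquely determined.
\<close>

definition krein_parameters ::
    "('v::finite \<Rightarrow> 'v \<Rightarrow> bool) \<Rightarrow> (nat \<Rightarrow> complex^'v^'v) \<Rightarrow>
     (nat \<Rightarrow> nat \<Rightarrow> nat \<Rightarrow> complex) \<Rightarrow> bool" where
  "krein_parameters adj E q \<longleftrightarrow>
     (\<forall>i\<le>diam adj. \<forall>j\<le>diam adj.
        E i * E j = (1 / of_nat CARD('v)) *m (\<Sum>h\<le>diam adj. q h i j *m E h))"

definition q_polynomial_ordering ::
    "('v::finite \<Rightarrow> 'v \<Rightarrow> bool) \<Rightarrow> (nat \<Rightarrow> complex^'v^'v) \<Rightarrow> bool" where
  "q_polynomial_ordering adj E \<longleftrightarrow>
     primitive_idempotents adj E \<and>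
     (\<exists>q. krein_parameters adj E q \<and>
        (\<forall>h\<le>diam adj. \<forall>i\<le>diam adj. \<forall>j\<le>diam adj.
           (h > i + j \<or> i > h + j \<or> j > h + i \<longrightarrow> q h i j = 0) \<and>
           (h = i + j \<or> i = h + j \<or> j = h + i \<longrightarrow> q h i j \<noteq> 0)))"

definition q_polynomial :: "('v::finite \<Rightarrow> 'v \<Rightarrow> bool) \<Rightarrow> bool" where
  "q_polynomial adj \<longleftrightarrow> (\<exists>E. q_polynomial_ordering adj E)"

definition two_homogeneous_bipartite :: "('v::finite \<Rightarrow> 'v \<Rightarrow> bool) \<Rightarrow> bool" where
  "two_homogeneous_bipartite adj \<longleftrightarrow>
     distance_regular adj \<and> bipartite adj \<and> antipodal_2_cover adj \<and> q_polynomial adj"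

definition is_hypercube :: "('v::finite \<Rightarrow> 'v \<Rightarrow> bool) \<Rightarrow> bool" where
  "is_hypercube adj \<longleftrightarrow>
     (\<exists>n f. bij_betw f (UNIV :: 'v set) {w :: bool list. length w = n} \<and>
        (\<forall>x y. adj x y \<longleftrightarrow> card {i. i < n \<and> f x ! i \<noteq> f y ! i} = 1))"

definition is_cycle :: "('v::finite \<Rightarrow> 'v \<Rightarrow> bool) \<Rightarrow> bool" where
  "is_cycle adj \<longleftrightarrow>
     (\<exists>n::nat. n \<ge> 3 \<and> (\<exists>f. bij_betw f (UNIV :: 'v set) {..<n} \<and>
        (\<forall>x y. adj x y \<longleftrightarrow> f y = (f x + 1) mod n \<or> f x = (f y + 1) mod n)))"


text \<open>
  The third tensor power of $V$ in coordinates: its basis vectors $x \otimes y \otimes z$ are the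
  \<open>axis (x, y, z) 1\<close>.
\<close>

definition tensor3 ::
    "complex^'v \<Rightarrow> complex^'v \<Rightarrow> complex^'v \<Rightarrow> complex^('v::finite \<times> 'v \<times> 'v)" where
  "tensor3 u v w = (\<chi> p. case p of (x, y, z) \<Rightarrow> u $ x * v $ y * w $ z)"

definition profiles :: "nat \<Rightarrow> (nat \<times> nat \<times> nat \<times> nat) set" where
  "profiles D = {(r, s, t, u). r + s + t + u = D}"

definition has_profile ::
    "('v::finite \<Rightarrow> 'v \<Rightarrow> bool) \<Rightarrow> 'v \<Rightarrow> 'v \<Rightarrow> 'v \<Rightarrow> nat \<times> nat \<times> nat \<times> nat \<Rightarrow> bool" where
  "has_profile adj x y z = (\<lambda>(r, s, t, u).
     (r, s, t, u) \<in> profiles (diam adj) \<and>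
     gdist adj x y = s + t \<and> gdist adj y z = t + u \<and> gdist adj z x = u + s)"

definition profile_vector ::
    "('v::finite \<Rightarrow> 'v \<Rightarrow> bool) \<Rightarrow> nat \<times> nat \<times> nat \<times> nat \<Rightarrow> complex^('v \<times> 'v \<times> 'v)" where
  "profile_vector adj p =
     (\<Sum>(x, y, z) | has_profile adj x y z p. tensor3 (axis x 1) (axis y 1) (axis z 1))"

definition Lambda_space :: "('v::finite \<Rightarrow> 'v \<Rightarrow> bool) \<Rightarrow> (complex^('v \<times> 'v \<times> 'v)) set" where
  "Lambda_space adj = vec.span (profile_vector adj ` profiles (diam adj))"

end

theory Submission
  imports Defs
begin

text \<open>
  The coordinates of the profile vectors are the indicator functions of pairwise disjoint sets of
  triples, so they are linearly independent as soon as each profile occurs for some triple of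
  vertices; then $\dim\Lambda$ is the number of profiles (\<open>dim_Lambda_space\<close>). The content of the
  theorem is therefore the existence of the triples, and this is where the structure of the graph
  enters. It fails for cycles: no three vertices of the 8-cycle have profile $(1,1,1,1)$. What sets
  the other graphs apart is that their intersection numbers $c_i = p^i_{1,i-1}$ strictly increase.

  If they do (\<open>card_toward_strict_mono\<close>), let $\partial(x,z)+\partial(y,z) < D$. The neighbours of
  $z$ farther from $x$ are those closer to the antipode of $x$, which is at distance
  $D-\partial(x,z) > \partial(y,z)$ from $z$; they are more than the neighbours of $z$ closer to $y$, so
  some neighbour of $z$ is farther from both $x$ and $y$. Starting at a point $z$ of a geodesic from
  $x$ to $y$, repeated use of this turns the profile $(r+u,s,t,0)$ into $(r,s,t,u)$ for $u\le r$, and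
  replacing $z$ by its antipode gives the profiles with $u>r$ (\<open>profile_realised\<close>).

  A double count of the edges between two consecutive sets of closer neighbours shows
  $c_i < c_{i+1}$ once $c_2\ge 2$ (\<open>card_toward_less_step\<close>).

  The inequality $c_2\ge 2$ is where the $Q$-polynomial property is used. For a vertex $x$ let $K$ be
  the diagonal matrix whose entries are those of row $x$ of $E_1$. The vanishing of the Krein
  parameters and the antipodality give $E_aKE_b=0$ unless $|a-b|=1$.
  If $A=\sum_a\theta_aE_a$ is the adjacency matrix, the recursion
  $s_a+s_{a+1}=\theta_a\theta_{a+1}$ therefore defines a matrix $S=\sum_a s_aE_a$ with $AKA=SK+KS$. Read
  at an entry $(y,z)$ with $\partial(y,z)=2$, and for all $x$ at once, this says that the sum of the
  columns of $E_1$ at the common neighbours of $y$ and $z$ is a fixed multiple of the sum of its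
  columns at $y$ and $z$ (\<open>common_sum_E1\<close>). If $c_2=1$ and a vertex $w$ has three neighbours
  $a,b,c$, this identity for the paths $a,w,b$ and $a,w,c$ makes the columns at $b$ and $c$ equal,
  whereas the columns of $E_1$ are distinct for a $Q$-polynomial ordering
  (\<open>two_common_neighbours\<close>). So $c_2=1$ forces valency two, and then the graph is a cycle
  (\<open>cycle_if_2_regular\<close>).
\<close>

section \<open>The path-length metric\<close>

locale connected_graph =
  fixes adj :: "'v::finite \<Rightarrow> 'v \<Rightarrow> bool"
  assumes graph: "simple_connected_graph adj"
begin

abbreviation d where "d \<equiv> gdist adj"
abbreviation D where "D \<equiv> diam adj"

lemma adj_sym: "adj x y \<Longrightarrow> adj y x"
  using graph unfolding simple_connected_graph_def symp_def by blast

lemma adj_irrefl: "\<not> adj x x"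
  using graph unfolding simple_connected_graph_def irreflp_def by blast

lemma walk_of_length_dist: "(adj ^^ d x y) x y"
proof -
  have "\<exists>n. (adj ^^ n) x y"
    using graph unfolding simple_connected_graph_def by (metis rtranclp_power)
  then show ?thesis unfolding gdist_def by (rule LeastI_ex)
qed

lemma dist_le_walk: "(adj ^^ n) x y \<Longrightarrow> d x y \<le> n"
  unfolding gdist_def by (rule Least_le)

lemma walk_sym: "(adj ^^ n) x y \<Longrightarrow> (adj ^^ n) y x"
proof (induction n arbitrary: y)
  case (Suc n)
  then obtain z where "(adj ^^ n) x z" "adj z y" by (blast elim: relpowp_Suc_E)
  with Suc.IH show ?case by (blast intro: relpowp_Suc_I2 adj_sym)
qed auto

lemma dist_sym: "d x y = d y x"
  by (meson antisym dist_le_walk walk_of_length_dist walk_sym)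

lemma dist_triangle: "d x z \<le> d x y + d y z"
  using walk_of_length_dist[of x y] walk_of_length_dist[of y z]
  by (intro dist_le_walk) (auto simp: relpowp_add)

lemma dist_0_iff [simp]: "d x y = 0 \<longleftrightarrow> x = y"
proof
  show "x = y" if "d x y = 0" using walk_of_length_dist[of x y] that by simp
  show "d x y = 0" if "x = y" using dist_le_walk[of 0 x y] that by simp
qed

lemma dist_self [simp]: "d x x = 0"
  by simp

lemma dist_1_iff: "d x y = 1 \<longleftrightarrow> adj x y"
proof
  show "adj x y" if "d x y = 1" using walk_of_length_dist[of x y] that by (simp only: relpowp_1)
  assume a: "adj x y"
  then have "d x y \<le> 1" by (intro dist_le_walk) (simp only: relpowp_1)
  moreover have "d x y \<noteq> 0" using a adj_irrefl by auto
  ultimately show "d x y = 1" by linarith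
qed

lemma dist_adj_le: "adj x y \<Longrightarrow> d x z \<le> Suc (d y z)"
  using dist_triangle[of x z y] dist_1_iff[of x y] by simp

lemma geodesic_point:
  assumes "d x y = i + j"
  obtains z where "d x z = i" "d z y = j"
proof -
  from walk_of_length_dist[of x y] assms obtain z where "(adj ^^ i) x z" "(adj ^^ j) z y"
    by (auto simp: relpowp_add)
  then have "d x z \<le> i" "d z y \<le> j" by (simp_all add: dist_le_walk)
  with dist_triangle[of x y z] assms have "d x z = i" "d z y = j" by linarith+
  then show ?thesis by (rule that)
qed

lemma finite_dists: "finite {d x y | x y. True}"
  by (rule finite_subset[of _ "range (\<lambda>(x, y). d x y)"]) auto

lemma dist_le_diam: "d x y \<le> D"
  unfolding diam_def by (intro Max_ge finite_dists) auto

lemma diam_attained: obtains x y where "d x y = D"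
proof -
  have "D \<in> {d x y | x y. True}"
    unfolding diam_def by (intro Max_in finite_dists) auto
  then show ?thesis using that by auto
qed

end

section \<open>Connected graphs of valency two\<close>

context connected_graph
begin

text \<open>
  A walk that never turns back must return; the first vertex that it repeats is its start, since
  any other vertex already has both of its neighbours among the earlier ones. The vertices passed
  until then are closed under adjacency, hence all of them.
\<close>

lemma cycle_if_2_regular:
  assumes reg: "\<And>x. card {y. adj x y} = 2"
  shows "is_cycle adj"
proof -
  have other_ex: "\<exists>w. w \<noteq> u \<and> {y. adj v y} = {u, w}" if "adj u v" for u v
  proof -
    obtain a b where ab: "{y. adj v y} = {a, b}" "a \<noteq> b"
      using reg[of v] by (auto simp: card_2_iff)
    moreover have "u \<in> {y. adj v y}" using that adj_sym by simp
    ultimately show ?thesis by (cases "u = a") auto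
  qed
  obtain a b :: 'v where ab: "adj a b"
    using reg by (metis Collect_empty_eq card.empty zero_neq_numeral)
  obtain other where other: "\<And>u v. adj u v \<Longrightarrow> other u v \<noteq> u \<and> {y. adj v y} = {u, other u v}"
    using other_ex by metis
  define e where "e n = ((\<lambda>(u, v). (v, other u v)) ^^ n) (a, b)" for n
  define p where "p n = fst (e n)" for n
  have e_Suc: "e (Suc n) = (snd (e n), other (fst (e n)) (snd (e n)))" for n
    by (simp add: e_def split_def)
  have e_adj: "adj (fst (e n)) (snd (e n))" for n
  proof (induction n)
    case 0
    then show ?case using ab by (simp add: e_def)
  next
    case (Suc n)
    then show ?case using other[OF Suc] unfolding e_Suc by auto
  qed
  have snd_e: "snd (e n) = p (Suc n)" for n by (simp add: p_def e_Suc)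
  have p_Suc: "p (Suc (Suc n)) = other (p n) (p (Suc n))" for n
    by (simp add: p_def e_Suc)
  have p_adj: "adj (p n) (p (Suc n))" for n
    using e_adj[of n] unfolding snd_e p_def[symmetric] .
  have p_neq: "p (Suc (Suc n)) \<noteq> p n" and nbrs: "{y. adj (p (Suc n)) y} = {p n, p (Suc (Suc n))}" for n
    using other[OF p_adj[of n]] unfolding p_Suc by blast+
  define N where "N = (LEAST n. \<exists>i<n. p i = p n)"
  have "\<exists>n. \<exists>i<n. p i = p n"
  proof -
    have "\<not> inj p" using finite_imageD[of p UNIV] infinite_UNIV_nat by auto
    then show ?thesis unfolding inj_def by (metis linorder_neqE_nat)
  qed
  then have "\<exists>i<N. p i = p N" unfolding N_def by (rule LeastI_ex)
  then obtain i0 where i0: "i0 < N" "p i0 = p N" by blast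
  have inj: "i = j" if "i < N" "j < N" "p i = p j" for i j
  proof -
    have "\<not> (\<exists>i<n. p i = p n)" if "n < N" for n
      using that not_less_Least unfolding N_def by blast
    then show ?thesis using that by (metis linorder_neqE_nat)
  qed
  have pN: "p N = p 0"
  proof (cases i0)
    case (Suc j)
    obtain M where M: "N = Suc M" using i0 by (cases N) auto
    have "p M \<in> {y. adj (p i0) y}" using p_adj[of M] adj_sym i0(2) M by simp
    then consider "p M = p j" | "p M = p (Suc i0)" using nbrs[of j] Suc by auto
    then show ?thesis
    proof cases
      case 1
      then show ?thesis using inj[of M j] Suc i0 M by auto
    next
      case 2
      have "i0 \<noteq> M" using 2 p_adj[of i0] adj_irrefl by metis
      then have "M = Suc i0" using 2 inj[of M "Suc i0"] i0 M by auto
      then show ?thesis using p_neq[of i0] i0 M by auto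
    qed
  qed (use i0 in simp)
  have "N \<noteq> 1" using p_adj[of 0] adj_irrefl pN by (metis One_nat_def)
  moreover have "N \<noteq> 2" using p_neq[of 0] pN by (auto simp: numeral_2_eq_2)
  ultimately have N3: "3 \<le> N" using i0 by linarith
  have next_adj: "adj (p i) (p ((i + 1) mod N))" if "i < N" for i
    using p_adj[of i] pN that by (cases "Suc i = N") auto
  have nbrs_mod: "\<exists>k<N. i = (k + 1) mod N \<and> {y. adj (p i) y} = {p k, p ((i + 1) mod N)}"
    if "i < N" for i
  proof (cases i)
    case 0
    obtain M where M: "N = Suc M" using N3 by (cases N) auto
    have "{p M, p 1} \<subseteq> {y. adj (p 0) y}"
      using p_adj[of 0] p_adj[of M] adj_sym pN M by auto
    moreover have "p M \<noteq> p 1" using inj[of M 1] M N3 by auto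
    ultimately have "{p M, p 1} = {y. adj (p 0) y}"
      using reg[of "p 0"] by (intro card_subset_eq) auto
    then show ?thesis using 0 M N3 by (intro exI[of _ M]) auto
  next
    case (Suc k)
    have "p (Suc i) = p ((i + 1) mod N)" using pN that by (cases "Suc i = N") auto
    then show ?thesis using nbrs[of k] Suc that by (intro exI[of _ k]) auto
  qed
  have adj_mod: "j = (i + 1) mod N \<or> i = (j + 1) mod N"
    if ij: "i < N" "j < N" "adj (p i) (p j)" for i j
  proof -
    obtain k where k: "k < N" "i = (k + 1) mod N" "{y. adj (p i) y} = {p k, p ((i + 1) mod N)}"
      using nbrs_mod[OF ij(1)] by blast
    then have "p j \<in> {p k, p ((i + 1) mod N)}" using ij(3) by blast
    moreover have "(i + 1) mod N < N" using N3 by simp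
    ultimately have "j = k \<or> j = (i + 1) mod N"
      using inj[OF ij(2) k(1)] inj[OF ij(2)] by blast
    with k(2) show ?thesis by blast
  qed
  have onto: "x \<in> p ` {..<N}" for x
  proof -
    have "adj\<^sup>*\<^sup>* (p 0) x" using graph unfolding simple_connected_graph_def by blast
    then show ?thesis
    proof induction
      case base
      then show ?case using i0 by auto
    next
      case (step y z)
      then obtain i where i: "i < N" "y = p i" by auto
      obtain k where k: "k < N" "{y. adj (p i) y} = {p k, p ((i + 1) mod N)}"
        using nbrs_mod[OF i(1)] by blast
      have "z \<in> {y. adj (p i) y}" using step(2) i(2) by simp
      then have "z = p k \<or> z = p ((i + 1) mod N)" unfolding k(2) by simp
      moreover have "(i + 1) mod N < N" using N3 by simp
      ultimately show ?case using k(1) by blast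
    qed
  qed
  have bij: "bij_betw p {..<N} UNIV"
    using inj onto by (auto simp: bij_betw_def inj_on_def)
  define f where "f = inv_into {..<N} p"
  have f: "f x < N" "p (f x) = x" for x
    using inv_into_into[OF onto[of x]] f_inv_into_f[OF onto[of x]] by (simp_all add: f_def)
  have next_f: "adj x y" if "f y = (f x + 1) mod N" for x y
    using next_adj[OF f(1)[of x]] unfolding that[symmetric] f(2) .
  have "adj x y \<longleftrightarrow> f y = (f x + 1) mod N \<or> f x = (f y + 1) mod N" for x y
    using adj_mod[OF f(1)[of x] f(1)[of y]] next_f[of y x] next_f[of x y] adj_sym[of y x]
    unfolding f(2) by blast
  moreover have "bij_betw f UNIV {..<N}"
    unfolding f_def by (rule bij_betw_inv_into[OF bij])
  ultimately show ?thesis unfolding is_cycle_def using N3 by blast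
qed

end

section \<open>Distance-regularity\<close>

locale drg = connected_graph adj for adj :: "'v::finite \<Rightarrow> 'v \<Rightarrow> bool" +
  assumes dist_reg: "distance_regular adj"
begin

text \<open>
  At distance two, this set has $c_2$ elements.
\<close>

definition common :: "'v \<Rightarrow> 'v \<Rightarrow> 'v set" where
  "common u v = {w. adj u w \<and> adj w v}"

text \<open>
  For $\partial(x,z)=i$, this set has $c_i$ elements.
\<close>

definition toward :: "'v \<Rightarrow> 'v \<Rightarrow> 'v set" where
  "toward x z = {y. adj x y \<and> Suc (d y z) = d x z}"

lemma card_sphere_inter:
  assumes "d x y = d u v"
  shows "card {z. d x z = i \<and> d y z = j} = card {z. d u z = i \<and> d v z = j}"
proof (cases "i \<le> D \<and> j \<le> D")
  case True
  then obtain n where "\<forall>x' y'. d x' y' = d x y \<longrightarrow>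
      card (sphere_at adj i x' \<inter> sphere_at adj j y') = n"
    using dist_reg dist_le_diam[of x y] unfolding distance_regular_def by blast
  with assms have "card (sphere_at adj i x \<inter> sphere_at adj j y) =
      card (sphere_at adj i u \<inter> sphere_at adj j v)" by simp
  then show ?thesis by (simp add: sphere_at_def Int_def)
next
  case False
  then have "{z. d x z = i \<and> d y z = j} = {}" "{z. d u z = i \<and> d v z = j} = {}"
    using dist_le_diam by auto
  then show ?thesis by (simp only:)
qed

text \<open>
  This is the form in which regularity gives the existence of vertices: a configuration found at
  one pair is available at every pair at the same distance.
\<close>

lemma realised_from_every_pair:
  assumes "d x y = d u v"
  obtains z' where "d x z' = d u z" "d y z' = d v z"
proof -
  have "z \<in> {w. d u w = d u z \<and> d v w = d v z}" by simp
  then have "card {w. d u w = d u z \<and> d v w = d v z} \<noteq> 0" by (auto simp: card_eq_0_iff)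
  with card_sphere_inter[OF assms] have "card {w. d x w = d u z \<and> d y w = d v z} \<noteq> 0" by simp
  then have "{w. d x w = d u z \<and> d y w = d v z} \<noteq> {}" by (auto simp: card_eq_0_iff)
  with that show ?thesis by blast
qed

text \<open>
  Such an extension exists at the pair of vertices at distances $0$ and $\partial(x,y)$ along a
  geodesic of length $D$, and regularity carries it over to \<open>x\<close> and \<open>y\<close>.
\<close>

lemma geodesic_extension:
  assumes "d x y + j \<le> D"
  obtains z where "d y z = j" "d x z = d x y + j"
proof -
  obtain u v where uv: "d u v = D" by (rule diam_attained)
  obtain v' where v': "d u v' = d x y + j"
    using geodesic_point[of u v "d x y + j" "D - (d x y + j)"] uv assms by auto
  then obtain w where w: "d u w = d x y" "d w v' = j" by (rule geodesic_point)
  obtain z where "d x z = d u v'" "d y z = d w v'"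
    using realised_from_every_pair[of x y u w v'] w(1) by metis
  with v' w(2) that show ?thesis by simp
qed

lemma card_toward_cong:
  assumes "d x z = d x' z'"
  shows "card (toward x z) = card (toward x' z')"
proof (cases "d x z")
  case 0
  then have "toward x z = {}" "toward x' z' = {}" using assms by (auto simp: toward_def)
  then show ?thesis by simp
next
  case (Suc n)
  have "toward x z = {y. d x y = 1 \<and> d z y = n}"
    using Suc by (auto simp: toward_def dist_sym[of z] dist_1_iff simp del: One_nat_def)
  moreover have "toward x' z' = {y. d x' y = 1 \<and> d z' y = n}"
    using Suc assms by (auto simp: toward_def dist_sym[of z'] dist_1_iff simp del: One_nat_def)
  ultimately show ?thesis using card_sphere_inter[OF assms] by simp
qed

lemma card_common_cong:
  assumes "d u v = d u' v'"
  shows "card (common u v) = card (common u' v')"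
proof -
  have "common a b = {w. d a w = 1 \<and> d b w = 1}" for a b
    unfolding common_def dist_1_iff by (auto intro: adj_sym)
  then show ?thesis using card_sphere_inter[OF assms] by simp
qed

lemma card_neighbours_cong: "card {y. adj x y} = card {y. adj u y}"
  using card_sphere_inter[of x x u u 1 1] by (simp add: dist_1_iff[symmetric] del: One_nat_def)

end

section \<open>Bipartite antipodal double covers\<close>

locale antipodal_bipartite_drg = drg adj for adj :: "'v::finite \<Rightarrow> 'v \<Rightarrow> bool" +
  assumes bip: "bipartite adj" and anti: "antipodal_2_cover adj" and D_ge: "2 \<le> diam adj"
begin

lemma intersection_number_eq:
  assumes "d x y = h" "i \<le> D" "j \<le> D"
  shows "intersection_number adj h i j = card (sphere_at adj i x \<inter> sphere_at adj j y)"
proof -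
  obtain n where n: "\<forall>x y. d x y = h \<longrightarrow> card (sphere_at adj i x \<inter> sphere_at adj j y) = n"
    using dist_reg dist_le_diam[of x y] assms unfolding distance_regular_def by blast
  have "intersection_number adj h i j = n"
    unfolding intersection_number_def using n assms(1) by (intro the_equality) auto
  then show ?thesis using n assms by simp
qed

lemma adj_dist_neq:
  assumes "adj y w"
  shows "d y z \<noteq> d w z"
proof
  assume eq: "d y z = d w z"
  have "intersection_number adj (d y z) 1 (d y z) = 0"
    using bip dist_le_diam[of y z] unfolding bipartite_def by auto
  then have "sphere_at adj 1 y \<inter> sphere_at adj (d y z) z = {}"
    using intersection_number_eq[of y z "d y z" 1 "d y z"] dist_le_diam[of y z] D_ge by simp
  moreover have "w \<in> sphere_at adj 1 y \<inter> sphere_at adj (d y z) z"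
    using assms eq by (simp add: sphere_at_def dist_1_iff[symmetric] dist_sym[of z])
  ultimately show False by auto
qed

lemma adj_dist_cases:
  assumes "adj y w"
  shows "d w z = Suc (d y z) \<or> d y z = Suc (d w z)"
  using adj_dist_neq[OF assms, of z] dist_adj_le[OF assms, of z] dist_adj_le[OF adj_sym[OF assms], of z]
  by linarith

lemma dist_2I:
  assumes "adj x y" "adj y z" "x \<noteq> z"
  shows "d x z = 2"
  using adj_dist_cases[OF assms(2), of x] assms dist_1_iff[of x y] 
  by (auto simp: dist_sym[of z x] dist_sym[of y x])

definition antipode :: "'v \<Rightarrow> 'v" where
  "antipode x = (THE y. d x y = D)"

lemma antipode_unique: "d x y = D \<longleftrightarrow> y = antipode x"
proof -
  have "card (sphere_at adj D x) = 1"
    using anti intersection_number_eq[of x x 0 D D] by (simp add: antipodal_2_cover_def)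
  then obtain v where "sphere_at adj D x = {v}" by (auto simp: card_1_singleton_iff)
  then have v: "d x y = D \<longleftrightarrow> y = v" for y by (auto simp: sphere_at_def)
  then have "antipode x = v" unfolding antipode_def by simp
  with v show ?thesis by simp
qed

lemma antipode_neq: "antipode x \<noteq> x"
  using antipode_unique[of x "antipode x"] D_ge by auto

lemma antipode_antipode [simp]: "antipode (antipode x) = x"
  using antipode_unique dist_sym by metis

text \<open>
  A geodesic from \<open>x\<close> to \<open>z\<close> extends to length $D$, and it can only end at the antipode of \<open>x\<close>.
\<close>

lemma dist_antipode: "d z x + d z (antipode x) = D"
proof -
  obtain v where v: "d z v = D - d x z" "d x v = D"
    using geodesic_extension[of x z "D - d x z"] dist_le_diam[of x z] by auto
  then show ?thesis using antipode_unique dist_le_diam[of x z] by (auto simp: dist_sym[of z x])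
qed

lemma dist_2_exists: obtains u v where "d u v = 2"
  using geodesic_point[of _ _ 2 "D - 2"] diam_attained D_ge by (metis le_add_diff_inverse)

lemma valency_ge_2: "2 \<le> card {y. adj x y}"
proof -
  obtain u v where uv: "d u v = 2" by (rule dist_2_exists)
  then obtain w where "d u w = 1" "d w v = 1"
    using geodesic_point[of u v 1 1] by auto
  then have "{u, v} \<subseteq> {y. adj w y}" using adj_sym dist_1_iff by blast
  moreover have "u \<noteq> v" using uv by auto
  ultimately have "2 \<le> card {y. adj w y}" using card_mono[of "{y. adj w y}" "{u, v}"] by simp
  then show ?thesis using card_neighbours_cong[of x w] by simp
qed

context
  assumes quad: "\<And>u v. d u v = 2 \<Longrightarrow> 2 \<le> card (common u v)"
begin

text \<open>
  Count the edges between \<open>toward y z\<close> and \<open>toward x z - {y}\<close>. A vertex \<open>w\<close> of the first set is at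
  distance two from \<open>x\<close>, and all common neighbours of \<open>w\<close> and \<open>x\<close> lie on geodesics from \<open>x\<close> to
  \<open>z\<close>; one of them is \<open>y\<close>, so \<open>w\<close> has exactly $c_2-1$ neighbours in the second set. A vertex of the
  second set is at distance two from \<open>y\<close> and shares with it the neighbour \<open>x\<close>, which is not in the
  first set, so it has at most $c_2-1$ neighbours there. As $c_2-1>0$, the second set is at least as
  large as the first.
\<close>

lemma card_toward_less_step:
  assumes y: "y \<in> toward x z"
  shows "card (toward y z) < card (toward x z)"
proof -
  obtain u v where uv: "d u v = 2" by (rule dist_2_exists)
  define m where "m = card (common u v)"
  have m2: "2 \<le> m" using quad uv by (simp add: m_def)
  have m: "card (common a b) = m" if "d a b = 2" for a b
    using card_common_cong[of a b u v] that uv by (simp add: m_def)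
  have xy: "adj x y" and dy: "Suc (d y z) = d x z" using y by (auto simp: toward_def)
  define B where "B = toward x z - {y}"
  have 1: "card {y' \<in> B. adj w y'} = m - 1" if w: "w \<in> toward y z" for w
  proof -
    have yw: "adj y w" and dw: "Suc (d w z) = d y z" using w by (auto simp: toward_def)
    have "x \<noteq> w" using dw dy by auto
    then have wx: "d w x = 2" using dist_2I xy yw adj_sym by blast
    have "{y' \<in> B. adj w y'} = common w x - {y}"
    proof (intro equalityI subsetI)
      fix y' assume "y' \<in> {y' \<in> B. adj w y'}"
      then show "y' \<in> common w x - {y}" by (auto simp: B_def toward_def common_def adj_sym)
    next
      fix y' assume y': "y' \<in> common w x - {y}"
      then have a: "adj w y'" "adj x y'" by (auto simp: common_def adj_sym)
      have "Suc (d y' z) = d x z"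
        using adj_dist_cases[OF a(1), of z] adj_dist_cases[OF a(2), of z] dw dy by linarith
      then show "y' \<in> {y' \<in> B. adj w y'}" using a y' by (auto simp: B_def toward_def)
    qed
    moreover have "y \<in> common w x" using xy yw by (auto simp: common_def adj_sym)
    ultimately show ?thesis using m[OF wx] by simp
  qed
  have 2: "card {w \<in> toward y z. adj w y'} \<le> m - 1" if y': "y' \<in> B" for y'
  proof -
    have a: "adj x y'" "y' \<noteq> y" using y' by (auto simp: B_def toward_def)
    then have yy: "d y y' = 2" using dist_2I xy adj_sym by blast
    have "{w \<in> toward y z. adj w y'} \<subseteq> common y y' - {x}"
      using dy by (auto simp: common_def toward_def)
    then have "card {w \<in> toward y z. adj w y'} \<le> card (common y y' - {x})"
      by (intro card_mono) auto
    also have "\<dots> = m - 1"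
      using m[OF yy] xy a by (subst card_Diff_singleton) (auto simp: common_def adj_sym)
    finally show ?thesis .
  qed
  have "card (toward y z) * (m - 1) = (\<Sum>w\<in>toward y z. card {y' \<in> B. adj w y'})"
    using 1 by simp
  also have "\<dots> = (\<Sum>y'\<in>B. card {w \<in> toward y z. adj w y'})"
    by (rule sum_multicount_gen) auto
  also have "\<dots> \<le> card B * (m - 1)"
    using sum_mono[OF 2, of B "\<lambda>x. x"] by simp
  finally have "card (toward y z) \<le> card B" using m2 by simp
  also have "\<dots> < card (toward x z)"
    unfolding B_def using y by (intro card_Diff1_less) auto
  finally show ?thesis .
qed

lemma card_toward_strict_mono:
  assumes "d u v < d x z"
  shows "card (toward u v) < card (toward x z)"
  using assms
proof (induction "d x z" arbitrary: x)
  case (Suc n)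
  obtain y where y: "d x y = 1" "d y z = n"
    using geodesic_point[of x z 1 n] Suc.hyps(2) by auto
  then have step: "card (toward y z) < card (toward x z)"
    using Suc.hyps(2) dist_1_iff by (intro card_toward_less_step) (auto simp: toward_def)
  show ?case
  proof (cases "d u v = n")
    case True
    then have "card (toward u v) = card (toward y z)" using y by (intro card_toward_cong) simp
    with step show ?thesis by simp
  next
    case False
    then have "card (toward u v) < card (toward y z)" using Suc y by auto
    with step show ?thesis by simp
  qed
qed simp

text \<open>
  Moving away from \<open>x\<close> is moving toward its antipode, and by strict monotonicity more neighbours of
  \<open>z\<close> lead toward the antipode of \<open>x\<close> than toward \<open>y\<close>.
\<close>

lemma neighbour_farther_from_both:
  assumes "d x z + d y z < D"
  obtains w where "d x w = Suc (d x z)" "d y w = Suc (d y z)"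
proof -
  have "d z y < d z (antipode x)"
    using dist_antipode[of z x] assms by (simp add: dist_sym[of z])
  then have "card (toward z y) < card (toward z (antipode x))"
    by (rule card_toward_strict_mono)
  then have "\<not> toward z (antipode x) \<subseteq> toward z y"
    using card_mono[of "toward z y"] by (meson finite leD)
  then obtain w where w: "w \<in> toward z (antipode x)" "w \<notin> toward z y" by blast
  then have zw: "adj z w" by (simp add: toward_def)
  have "d w x = Suc (d z x)"
    using w(1) dist_antipode[of z x] dist_antipode[of w x] by (auto simp: toward_def)
  moreover have "d w y = Suc (d z y)"
    using w(2) zw adj_dist_cases[OF zw, of y] by (auto simp: toward_def)
  ultimately show ?thesis using that by (simp add: dist_sym)
qed

text \<open>
  Start with \<open>z\<close> on a geodesic from \<open>x\<close> to \<open>y\<close> and move it away from both \<open>u\<close> times. Before step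
  $v+1$ the two distances add up to $s+t+2v$, which is below $D=r+s+t+u$ because $v<u\le r$.
\<close>

lemma profile_realised_small:
  assumes "r + s + t + u = D" "u \<le> r"
  shows "\<exists>x y z. d x y = s + t \<and> d y z = t + u \<and> d x z = u + s"
proof -
  obtain x' y' where "d x' y' = D" by (rule diam_attained)
  then have "d x' y' = (s + t) + (r + u)" using assms by simp
  then obtain y where xy: "d x' y = s + t" by (rule geodesic_point)
  have "\<exists>z. d y z = t + v \<and> d x' z = v + s" if "v \<le> u" for v
    using that
  proof (induction v)
    case 0
    from geodesic_point[OF xy] show ?case by (metis dist_sym add_0 add.right_neutral)
  next
    case (Suc v)
    then obtain z where z: "d y z = t + v" "d x' z = v + s" by auto
    then have "d x' z + d y z < D" using Suc.prems assms by linarith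
    then obtain w where "d x' w = Suc (d x' z)" "d y w = Suc (d y z)"
      by (rule neighbour_farther_from_both)
    with z show ?case by auto
  qed
  with xy show ?thesis by blast
qed

text \<open>
  Replacing \<open>z\<close> by its antipode turns the profile $(u,t,s,r)$ into $(r,s,t,u)$.
\<close>

lemma profile_realised:
  assumes sum: "r + s + t + u = D"
  shows "\<exists>x y z. d x y = s + t \<and> d y z = t + u \<and> d x z = u + s"
proof (cases "u \<le> r")
  case True
  then show ?thesis using profile_realised_small sum by blast
next
  case False
  have "u + t + s + r = D" "r \<le> u" using sum False by auto
  from profile_realised_small[OF this]
  obtain x y z where xyz: "d x y = t + s" "d y z = s + r" "d x z = r + t" by blast
  have "d y (antipode z) = t + u" "d x (antipode z) = u + s"
    using dist_antipode[of y z] dist_antipode[of x z] xyz sum by auto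
  with xyz show ?thesis by (metis add.commute)
qed

end

end

section \<open>The first idempotent of a Q-polynomial ordering\<close>

lemma mscale_nth [simp]: "(c *m A) $ x $ y = c * A $ x $ y"
  by (simp add: mscale_def map_matrix_def)

lemma sum_swap_3_1:
  "(\<Sum>x\<in>A. \<Sum>y\<in>B. \<Sum>z\<in>C. \<Sum>w\<in>W. f x y z w) = (\<Sum>w\<in>W. \<Sum>x\<in>A. \<Sum>y\<in>B. \<Sum>z\<in>C. f x y z w)"
proof -
  have "(\<Sum>x\<in>A. \<Sum>y\<in>B. \<Sum>z\<in>C. \<Sum>w\<in>W. f x y z w) = (\<Sum>x\<in>A. \<Sum>y\<in>B. \<Sum>w\<in>W. \<Sum>z\<in>C. f x y z w)"
    by (rule sum.cong[OF refl], rule sum.cong[OF refl], rule sum.swap)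
  also have "\<dots> = (\<Sum>x\<in>A. \<Sum>w\<in>W. \<Sum>y\<in>B. \<Sum>z\<in>C. f x y z w)"
    by (rule sum.cong[OF refl], rule sum.swap)
  also have "\<dots> = (\<Sum>w\<in>W. \<Sum>x\<in>A. \<Sum>y\<in>B. \<Sum>z\<in>C. f x y z w)"
    by (rule sum.swap)
  finally show ?thesis .
qed

locale q_polynomial_drg = antipodal_bipartite_drg adj for adj :: "'v::finite \<Rightarrow> 'v \<Rightarrow> bool" +
  fixes E :: "nat \<Rightarrow> complex^'v^'v" and q :: "nat \<Rightarrow> nat \<Rightarrow> nat \<Rightarrow> complex"
  assumes idem: "primitive_idempotents adj E"
    and krein: "krein_parameters adj E q"
    and q_triangle: "\<And>h i j. \<lbrakk>h \<le> diam adj; i \<le> diam adj; j \<le> diam adj;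
      h > i + j \<or> i > h + j \<or> j > h + i\<rbrakk> \<Longrightarrow> q h i j = 0"
    and q_extremal: "\<And>i j. i + j \<le> diam adj \<Longrightarrow> q (i + j) i j \<noteq> 0"
begin

\<comment> \<open>The index of \<open>E 1\<close> must keep its form for rewriting.\<close>
declare One_nat_def [simp del]

lemma distance_matrix_nth: "distance_matrix adj i $ x $ y = (if d x y = i then 1 else 0)"
  by (simp add: distance_matrix_def sphere_at_def dist_sym)

text \<open>
  The Bose-Mesner algebra consists of the matrices whose entries are functions of the distance, so
  expanding and recombining along the idempotents become the two statements
  \<open>idempotent_expansion\<close> and \<open>combination_depends_on_dist\<close>.
\<close>

lemma bose_mesner_iff: "B \<in> bose_mesner adj \<longleftrightarrow> (\<exists>f. \<forall>x y. B $ x $ y = f (d x y))"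
proof
  have "bose_mesner adj \<subseteq> {B. \<exists>f. \<forall>x y. B $ x $ y = f (d x y)}"
    unfolding bose_mesner_def
  proof (rule cmat.span_minimal)
    show "distance_matrix adj ` {..D} \<subseteq> {B. \<exists>f. \<forall>x y. B $ x $ y = f (d x y)}"
      by (auto simp: distance_matrix_nth)
    show "cmat.subspace {B :: complex^'v^'v. \<exists>f. \<forall>x y. B $ x $ y = f (d x y)}"
      unfolding cmat.subspace_def
    proof (safe, goal_cases)
      case (2 A B f g)
      then show ?case by (intro exI[of _ "\<lambda>n. f n + g n"]) simp
    next
      case (3 c A f)
      then show ?case by (intro exI[of _ "\<lambda>n. c * f n"]) simp
    qed auto
  qed
  then show "\<exists>f. \<forall>x y. B $ x $ y = f (d x y)" if "B \<in> bose_mesner adj" using that by blast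
next
  assume "\<exists>f. \<forall>x y. B $ x $ y = f (d x y)"
  then obtain f where f: "\<And>x y. B $ x $ y = f (d x y)" by blast
  have "B = (\<Sum>i\<le>D. f i *m distance_matrix adj i)"
    by (simp add: vec_eq_iff sum_component distance_matrix_nth f dist_le_diam if_distrib cong: if_cong)
  moreover have "(\<Sum>i\<le>D. f i *m distance_matrix adj i) \<in> bose_mesner adj"
    unfolding bose_mesner_def by (intro cmat.span_sum cmat.span_scale cmat.span_base imageI)
  ultimately show "B \<in> bose_mesner adj" by simp
qed

lemma span_E: "cmat.span (E ` {..D}) = bose_mesner adj" and inj_E: "inj_on E {..D}"
  using idem by (simp_all add: primitive_idempotents_def)

lemma idempotent_expansion: "\<exists>s. \<forall>x y. f (d x y) = (\<Sum>a\<le>D. s a * E a $ x $ y)"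
proof -
  have "(\<chi> x y. f (d x y)) \<in> cmat.span (E ` {..D})"
    unfolding span_E bose_mesner_iff by auto
  then obtain u where "(\<chi> x y. f (d x y)) = (\<Sum>B\<in>E ` {..D}. u B *m B)"
    by (auto simp: cmat.span_finite)
  then have "(\<chi> x y. f (d x y)) = (\<Sum>a\<le>D. u (E a) *m E a)"
    by (simp add: sum.reindex[OF inj_E])
  then have "f (d x y) = (\<Sum>a\<le>D. u (E a) * E a $ x $ y)" for x y
    by (simp add: vec_eq_iff sum_component)
  then show ?thesis by (intro exI[of _ "\<lambda>a. u (E a)"]) simp
qed

lemma combination_depends_on_dist: "\<exists>f. \<forall>x y. (\<Sum>a\<le>D. s a * E a $ x $ y) = f (d x y)"
proof -
  have "(\<Sum>a\<le>D. s a *m E a) \<in> bose_mesner adj"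
    unfolding span_E[symmetric] by (intro cmat.span_sum cmat.span_scale cmat.span_base imageI)
  then show ?thesis unfolding bose_mesner_iff by (simp add: sum_component)
qed

lemma E_depends_on_dist: "a \<le> D \<Longrightarrow> \<exists>f. \<forall>x y. E a $ x $ y = f (d x y)"
  unfolding bose_mesner_iff[symmetric] span_E[symmetric] by (auto intro: cmat.span_base)

lemma E_sym: "a \<le> D \<Longrightarrow> E a $ x $ y = E a $ y $ x"
  using E_depends_on_dist dist_sym by metis

lemma E_mult:
  assumes "a \<le> D" "b \<le> D"
  shows "(\<Sum>w\<in>UNIV. E a $ x $ w * E b $ w $ y) = (if a = b then E a $ x $ y else 0)"
proof -
  have "(E a ** E b) $ x $ y = (if a = b then E a else 0) $ x $ y"
    using idem assms by (simp add: primitive_idempotents_def)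
  then show ?thesis by (simp add: matrix_matrix_mult_def)
qed

lemma E_sum: "(\<Sum>a\<le>D. E a $ x $ y) = (if x = y then 1 else 0)"
proof -
  have "(\<Sum>a\<le>D. E a) $ x $ y = mat 1 $ x $ y"
    using idem by (simp add: primitive_idempotents_def)
  then show ?thesis by (simp add: sum_component mat_def)
qed

lemma E_nonzero:
  assumes "a \<le> D"
  obtains x y where "E a $ x $ y \<noteq> 0"
proof -
  have "cmat.independent (E ` {..D})"
    using idem unfolding primitive_idempotents_def by blast
  then have "0 \<notin> E ` {..D}"
    by (rule contrapos_nn) (rule cmat.dependent_zero)
  then have "E a \<noteq> 0" using assms by force
  then show ?thesis using that by (auto simp: vec_eq_iff)
qed

lemma combination_mult_E:
  assumes "a \<le> D"
  shows "(\<Sum>w\<in>UNIV. (\<Sum>b\<le>D. s b * E b $ x $ w) * E a $ w $ y) = s a * E a $ x $ y"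
proof -
  have "(\<Sum>w\<in>UNIV. (\<Sum>b\<le>D. s b * E b $ x $ w) * E a $ w $ y) =
      (\<Sum>b\<le>D. s b * (\<Sum>w\<in>UNIV. E b $ x $ w * E a $ w $ y))"
    by (simp add: sum_distrib_left sum_distrib_right mult.assoc) (rule sum.swap)
  also have "\<dots> = (\<Sum>b\<le>D. if b = a then s a * E a $ x $ y else 0)"
    using assms by (intro sum.cong) (auto simp: E_mult)
  finally show ?thesis using assms by simp
qed

text \<open>
  The conjugate \<open>F\<close> of \<open>E a\<close> is an idempotent of the Bose-Mesner algebra, so $F E_a=s_aE_a$ for some
  scalar. It is nonzero because the diagonal entries of $FE_a$ are the square norms of the rows of
  the symmetric matrix $E_a$. Conjugation gives $\overline{s_a}F=s_aE_a$, and multiplying this by $F$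
  gives $s_aE_a=s_a^2E_a$, whence $s_a=1$.
\<close>

lemma E_real:
  assumes a: "a \<le> D"
  shows "cnj (E a $ x $ y) = E a $ x $ y"
proof -
  obtain f where f: "\<And>x y. E a $ x $ y = f (d x y)" using E_depends_on_dist[OF a] by blast
  obtain s where s: "\<And>x y. cnj (E a $ x $ y) = (\<Sum>b\<le>D. s b * E b $ x $ y)"
    using idempotent_expansion[of "\<lambda>n. cnj (f n)"] f by auto
  have left: "(\<Sum>w\<in>UNIV. cnj (E a $ x $ w) * E a $ w $ y) = s a * E a $ x $ y" for x y
    unfolding s by (rule combination_mult_E[OF a])
  have sym: "cnj (s a) * cnj (E a $ x $ y) = s a * E a $ x $ y" for x y
  proof -
    have "cnj (s a) * cnj (E a $ x $ y) = cnj (\<Sum>w\<in>UNIV. cnj (E a $ x $ w) * E a $ w $ y)"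
      by (simp add: left)
    also have "\<dots> = (\<Sum>w\<in>UNIV. cnj (E a $ y $ w) * E a $ w $ x)"
      by (simp add: E_sym[OF a, of x] E_sym[OF a, of _ y] mult.commute)
    also have "\<dots> = s a * E a $ x $ y" by (simp add: left E_sym[OF a, of x])
    finally show ?thesis .
  qed
  obtain u v where uv: "E a $ u $ v \<noteq> 0" using E_nonzero[OF a] .
  have "s a \<noteq> 0"
  proof
    assume "s a = 0"
    have "complex_of_real (\<Sum>w\<in>UNIV. (cmod (E a $ u $ w))\<^sup>2) =
        (\<Sum>w\<in>UNIV. cnj (E a $ u $ w) * E a $ w $ u)"
      unfolding of_real_sum complex_norm_square
      by (intro sum.cong) (simp_all add: E_sym[OF a, of u] mult.commute)
    also have "\<dots> = 0" by (simp add: left \<open>s a = 0\<close>)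
    finally have "(\<Sum>w\<in>UNIV. (cmod (E a $ u $ w))\<^sup>2) = 0" by (simp only: of_real_eq_0_iff)
    then show False using uv by (simp add: sum_nonneg_eq_0_iff)
  qed
  have "s a * E a $ u $ v = cnj (s a) * cnj (\<Sum>w\<in>UNIV. E a $ u $ w * E a $ w $ v)"
    using a sym by (simp add: E_mult)
  also have "\<dots> = (\<Sum>w\<in>UNIV. cnj (E a $ u $ w) * (cnj (s a) * cnj (E a $ w $ v)))"
    by (simp add: sum_distrib_left mult_ac)
  also have "\<dots> = s a * (\<Sum>w\<in>UNIV. cnj (E a $ u $ w) * E a $ w $ v)"
    unfolding sym by (simp add: sum_distrib_left mult_ac)
  also have "\<dots> = s a * (s a * E a $ u $ v)" by (simp add: left)
  finally have "s a = 1" using uv \<open>s a \<noteq> 0\<close> by simp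
  with sym[of x y] show ?thesis by simp
qed

lemma krein_nth:
  assumes "i \<le> D" "j \<le> D"
  shows "E i $ x $ y * E j $ x $ y = (1 / of_nat CARD('v)) * (\<Sum>h\<le>D. q h i j * E h $ x $ y)"
proof -
  have "(E i * E j) $ x $ y = ((1 / of_nat CARD('v)) *m (\<Sum>h\<le>D. q h i j *m E h)) $ x $ y"
    using krein assms by (simp add: krein_parameters_def)
  then show ?thesis by (simp add: sum_component)
qed

text \<open>
  For a $Q$-polynomial ordering $E_{j+1}$ is a combination of the entrywise product $E_1\circ E_j$ and
  of $E_0,\dots,E_j$. Two equal columns of $E_1$ therefore give equal columns of every $E_j$, hence of
  their sum, the identity matrix.
\<close>

lemma E1_separates_vertices:
  assumes eq: "\<And>x. E 1 $ x $ y = E 1 $ x $ z"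
  shows "y = z"
proof -
  have step: "E (Suc j) $ x $ y = E (Suc j) $ x $ z"
    if IH: "\<And>h. h \<le> j \<Longrightarrow> E h $ x $ y = E h $ x $ z" and j: "Suc j \<le> D" for j x
  proof -
    have expand: "E 1 $ x $ v * E j $ x $ v = (1 / of_nat CARD('v)) *
        ((\<Sum>h\<le>j. q h 1 j * E h $ x $ v) + q (Suc j) 1 j * E (Suc j) $ x $ v)" for v
    proof -
      have "(\<Sum>h\<le>D. q h 1 j * E h $ x $ v) = (\<Sum>h\<le>Suc j. q h 1 j * E h $ x $ v)"
        using j q_triangle by (intro sum.mono_neutral_right) auto
      then show ?thesis using krein_nth[of 1 j x v] j D_ge by simp
    qed
    have "(\<Sum>h\<le>j. q h 1 j * E h $ x $ y) = (\<Sum>h\<le>j. q h 1 j * E h $ x $ z)"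
      using IH by (intro sum.cong) auto
    moreover have "E 1 $ x $ y * E j $ x $ y = E 1 $ x $ z * E j $ x $ z" using eq IH by simp
    moreover have "q (Suc j) 1 j \<noteq> 0" using q_extremal[of 1 j] j unfolding plus_1_eq_Suc by simp
    ultimately show ?thesis using expand[of y] expand[of z] by simp
  qed
  have "E 0 $ x $ v = 1 / of_nat CARD('v)" for x v
  proof -
    have "E 0 $ x $ v = ((1 / of_nat CARD('v)) *m (\<Sum>i\<le>D. distance_matrix adj i)) $ x $ v"
      using idem by (simp add: primitive_idempotents_def)
    then show ?thesis by (simp add: sum_component distance_matrix_nth dist_le_diam)
  qed
  then have E0: "E 0 $ x $ y = E 0 $ x $ z" for x by simp
  have "E j $ x $ y = E j $ x $ z" if "j \<le> D" for j x
    using that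
  proof (induction j rule: less_induct)
    case (less j)
    show ?case
    proof (cases j)
      case (Suc i)
      have "E h $ x $ y = E h $ x $ z" if "h \<le> i" for h
        using less Suc that by simp
      then show ?thesis using step less.prems Suc by blast
    qed (use E0 in simp)
  qed
  then have "(\<Sum>a\<le>D. E a $ y $ y) = (\<Sum>a\<le>D. E a $ y $ z)" by (intro sum.cong) auto
  then show ?thesis by (simp add: E_sum split: if_splits)
qed

text \<open>
  The antipodal map is the permutation matrix $A_D$, an involution in the Bose-Mesner algebra; it
  acts on each idempotent by an eigenvalue \<open>s\<close>.
\<close>

lemma E_antipode:
  assumes a: "a \<le> D"
  shows "\<exists>s. s * s = 1 \<and> (\<forall>x y. E a $ x $ antipode y = s * E a $ x $ y)"
proof -
  obtain s where s: "\<And>x y. (if d x y = D then 1 else 0) = (\<Sum>b\<le>D. s b * E b $ x $ y)"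
    using idempotent_expansion[of "\<lambda>n. if n = D then 1 else 0"] by auto
  have anti: "E a $ x $ antipode y = s a * E a $ x $ y" for x y
  proof -
    have "s a * E a $ y $ x = (\<Sum>w\<in>UNIV. (if d y w = D then 1 else 0) * E a $ w $ x)"
      unfolding s by (rule combination_mult_E[OF a, symmetric])
    also have "\<dots> = E a $ antipode y $ x"
      by (simp add: antipode_unique if_distrib[of "\<lambda>t. t * _"] cong: if_cong)
    finally show ?thesis using E_sym[OF a] by metis
  qed
  obtain u v where "E a $ u $ v \<noteq> 0" using E_nonzero[OF a] .
  moreover have "E a $ u $ v = s a * (s a * E a $ u $ v)"
    using anti[of u v] anti[of u "antipode v"] by simp
  ultimately have "s a * s a = 1" by simp
  with anti show ?thesis by blast
qed

text \<open>
  The sign is $-1$ since the columns of $E_1$ at a vertex and at its antipode differ.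
\<close>

lemma E1_antipode: "E 1 $ x $ antipode y = - E 1 $ x $ y"
proof -
  obtain s where s: "s * s = 1" "\<And>x y. E 1 $ x $ antipode y = s * E 1 $ x $ y"
    using E_antipode[of 1] D_ge by auto
  have "s \<noteq> 1"
  proof
    assume "s = 1"
    then have "antipode y = y" using s(2) by (intro E1_separates_vertices) simp
    then show False using antipode_neq by simp
  qed
  with s(1) have "s = -1" by (simp add: square_eq_1_iff)
  with s(2) show ?thesis by simp
qed

text \<open>
  This is the entry $(y,z)$ of $E_aKE_b$, where $K$ is the diagonal matrix of the row \<open>x\<close> of $E_1$.
\<close>

definition triple :: "nat \<Rightarrow> nat \<Rightarrow> 'v \<Rightarrow> 'v \<Rightarrow> 'v \<Rightarrow> complex" where
  "triple a b x y z = (\<Sum>w\<in>UNIV. E a $ y $ w * E 1 $ x $ w * E b $ w $ z)"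

text \<open>
  The substitution of \<open>w\<close> by its antipode in the sum multiplies the term $E_1(x,w)$ by $-1$, and the
  two others by the same sign.
\<close>

lemma triple_same:
  assumes a: "a \<le> D"
  shows "triple a a x y z = 0"
proof -
  obtain s where s: "s * s = 1" "\<And>x y. E a $ x $ antipode y = s * E a $ x $ y"
    using E_antipode[OF a] by auto
  have s': "E a $ antipode x $ y = s * E a $ x $ y" for x y
    using s(2)[of y x] E_sym[OF a] by metis
  have "bij antipode" by (rule o_bij[of antipode]) auto
  then have "triple a a x y z =
      (\<Sum>w\<in>UNIV. E a $ y $ antipode w * E 1 $ x $ antipode w * E a $ antipode w $ z)"
    unfolding triple_def by (rule sum.reindex_bij_betw[symmetric])
  also have "\<dots> = (\<Sum>w\<in>UNIV. - (s * s) * (E a $ y $ w * E 1 $ x $ w * E a $ w $ z))"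
    by (simp add: E1_antipode s(2) s' mult_ac)
  also have "\<dots> = - triple a a x y z"
    by (simp add: s(1) triple_def sum_negf)
  finally show ?thesis by simp
qed

text \<open>
  The values of \<open>triple\<close> are real, so it is enough that their squares have sum zero. Summing over
  \<open>x\<close>, \<open>y\<close> and \<open>z\<close> first, the idempotents contract and leave the sum of all entries of
  $E_1\circ E_a\circ E_b$. Expanding $E_a\circ E_b$ by the Krein parameters, this is
  $|X|^{-1}\sum_h q^h_{a,b}$ times the trace of $E_hE_1$, where only $h=1$ contributes.
\<close>

lemma triple_zero_if_krein:
  assumes a: "a \<le> D" and b: "b \<le> D" and q0: "q 1 a b = 0"
  shows "triple a b x y z = 0"
proof -
  have D1: "1 \<le> D" using D_ge by simp
  have "(\<Sum>x\<in>UNIV. \<Sum>y\<in>UNIV. \<Sum>z\<in>UNIV. triple a b x y z * triple a b x y z) =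
    (\<Sum>x\<in>UNIV. \<Sum>y\<in>UNIV. \<Sum>z\<in>UNIV. \<Sum>w\<in>UNIV. \<Sum>v\<in>UNIV.
      (E 1 $ w $ x * E 1 $ x $ v) * (E a $ w $ y * E a $ y $ v) * (E b $ w $ z * E b $ z $ v))"
    unfolding triple_def sum_product
    by (intro sum.cong refl) (simp add: E_sym[OF D1] E_sym[OF a] E_sym[OF b] mult_ac)
  also have "\<dots> = (\<Sum>w\<in>UNIV. \<Sum>v\<in>UNIV. \<Sum>x\<in>UNIV. \<Sum>y\<in>UNIV. \<Sum>z\<in>UNIV. 
      (E 1 $ w $ x * E 1 $ x $ v) * (E a $ w $ y * E a $ y $ v) * (E b $ w $ z * E b $ z $ v))"
    by (subst sum_swap_3_1, rule sum.cong[OF refl], rule sum_swap_3_1)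
  also have "\<dots> = (\<Sum>w\<in>UNIV. \<Sum>v\<in>UNIV. (\<Sum>x\<in>UNIV. E 1 $ w $ x * E 1 $ x $ v) *
      (\<Sum>y\<in>UNIV. E a $ w $ y * E a $ y $ v) * (\<Sum>z\<in>UNIV. E b $ w $ z * E b $ z $ v))"
    by (simp only: sum_distrib_left[symmetric] sum_distrib_right[symmetric])
  also have "\<dots> = (\<Sum>w\<in>UNIV. \<Sum>v\<in>UNIV. (E a $ w $ v * E b $ w $ v) * E 1 $ w $ v)"
    using a b D1 by (simp add: E_mult mult_ac)
  also have "\<dots> = (\<Sum>w\<in>UNIV. \<Sum>v\<in>UNIV.
      1 / of_nat CARD('v) * ((\<Sum>h\<le>D. q h a b * E h $ w $ v) * E 1 $ v $ w))"
    unfolding krein_nth[OF a b] mult.assoc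
    by (intro sum.cong refl) (metis E_sym[OF D1])
  also have "\<dots> = (\<Sum>w\<in>UNIV. 1 / of_nat CARD('v) * (q 1 a b * E 1 $ w $ w))"
    by (simp only: sum_distrib_left[symmetric] combination_mult_E[OF D1])
  also have "\<dots> = 0" using q0 by simp
  finally have "(\<Sum>x\<in>UNIV. \<Sum>y\<in>UNIV. \<Sum>z\<in>UNIV. triple a b x y z * triple a b x y z) = 0" .
  moreover have sq: "triple a b x y z * triple a b x y z = of_real ((cmod (triple a b x y z))\<^sup>2)" for x y z
  proof -
    have "cnj (triple a b x y z) = triple a b x y z"
      unfolding triple_def using a b D1 by (simp add: E_real)
    then show ?thesis
      using complex_norm_square[of "triple a b x y z"] by (simp only: of_real_power)
  qed
  ultimately have "complex_of_real (\<Sum>x\<in>UNIV. \<Sum>y\<in>UNIV. \<Sum>z\<in>UNIV. (cmod (triple a b x y z))\<^sup>2) = 0"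
    by (simp only: sq of_real_sum)
  then have "(\<Sum>x\<in>UNIV. \<Sum>y\<in>UNIV. \<Sum>z\<in>UNIV. (cmod (triple a b x y z))\<^sup>2) = 0"
    by (simp only: of_real_eq_0_iff)
  then show ?thesis by (simp add: sum_nonneg_eq_0_iff sum_nonneg)
qed

lemma triple_zero:
  assumes a: "a \<le> D" and b: "b \<le> D" and ab: "b \<noteq> Suc a" "a \<noteq> Suc b"
  shows "triple a b x y z = 0"
proof (cases "a = b")
  case False
  then have "q 1 a b = 0" using a b ab D_ge by (intro q_triangle) auto
  then show ?thesis using triple_zero_if_krein a b by blast
qed (use triple_same a in simp)

text \<open>
  This is the expansion of $SKT$ for $S=\sum_a s_aE_a$ and $T=\sum_b t_bE_b$; the products $AKA$, $SK$
  and $KS$ are instances, the last two with the identity matrix as a factor.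
\<close>

lemma combination_triple:
  "(\<Sum>w\<in>UNIV. (\<Sum>a\<le>D. s a * E a $ y $ w) * E 1 $ x $ w * (\<Sum>b\<le>D. t b * E b $ w $ z)) =
    (\<Sum>a\<le>D. \<Sum>b\<le>D. s a * t b * triple a b x y z)"
proof -
  have "(\<Sum>w\<in>UNIV. (\<Sum>a\<le>D. s a * E a $ y $ w) * E 1 $ x $ w * (\<Sum>b\<le>D. t b * E b $ w $ z)) =
    (\<Sum>w\<in>UNIV. \<Sum>a\<le>D. \<Sum>b\<le>D. s a * t b * (E a $ y $ w * E 1 $ x $ w * E b $ w $ z))"
    by (simp add: sum_product sum_distrib_left sum_distrib_right mult_ac)
  also have "\<dots> = (\<Sum>a\<le>D. \<Sum>w\<in>UNIV. \<Sum>b\<le>D. s a * t b * (E a $ y $ w * E 1 $ x $ w * E b $ w $ z))"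
    by (rule sum.swap)
  also have "\<dots> = (\<Sum>a\<le>D. \<Sum>b\<le>D. \<Sum>w\<in>UNIV. s a * t b * (E a $ y $ w * E 1 $ x $ w * E b $ w $ z))"
    by (rule sum.cong[OF refl], rule sum.swap)
  finally show ?thesis by (simp add: triple_def sum_distrib_left)
qed

text \<open>
  The entry $(y,z)$ of $AKA=SK+KS$, where \<open>s\<close> solves $s_a+s_{a+1}=\theta_a\theta_{a+1}$. It matters
  that $S$ lies in the Bose-Mesner algebra and is the same for all \<open>x\<close>: the factor depends on
  $\partial(y,z)$ only.
\<close>

lemma common_sum_E1:
  "\<exists>\<sigma>. \<forall>x y z. (\<Sum>w\<in>common y z. E 1 $ x $ w) = \<sigma> (d y z) * (E 1 $ x $ y + E 1 $ x $ z)"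
proof -
  obtain \<theta> where \<theta>: "\<And>x y. (if adj x y then 1 else 0) = (\<Sum>a\<le>D. \<theta> a * E a $ x $ y)"
    using idempotent_expansion[of "\<lambda>n. if n = 1 then 1 else 0"] by (auto simp: dist_1_iff simp del: One_nat_def)
  \<comment> \<open>The initial value is arbitrary: only sums of consecutive terms matter.\<close>
  define s where "s = rec_nat 0 (\<lambda>a r. \<theta> a * \<theta> (Suc a) - r)"
  have s: "s a + s (Suc a) = \<theta> a * \<theta> (Suc a)" for a by (simp add: s_def)
  obtain \<sigma> where \<sigma>: "\<And>x y. (\<Sum>a\<le>D. s a * E a $ x $ y) = \<sigma> (d x y)"
    using combination_depends_on_dist by blast
  have "(\<Sum>w\<in>common y z. E 1 $ x $ w) = \<sigma> (d y z) * (E 1 $ x $ y + E 1 $ x $ z)" for x y z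
  proof -
    have "(\<Sum>w\<in>common y z. E 1 $ x $ w) =
        (\<Sum>w\<in>UNIV. (if adj y w then 1 else 0) * E 1 $ x $ w * (if adj w z then 1 else 0))"
      by (rule sum.mono_neutral_cong_left) (auto simp: common_def)
    also have "\<dots> = (\<Sum>a\<le>D. \<Sum>b\<le>D. \<theta> a * \<theta> b * triple a b x y z)"
      unfolding \<theta> by (rule combination_triple)
    also have "\<dots> = (\<Sum>a\<le>D. \<Sum>b\<le>D. (s a * 1) * triple a b x y z + (1 * s b) * triple a b x y z)"
    proof (intro sum.cong refl)
      fix a b assume ab: "a \<in> {..D}" "b \<in> {..D}"
      show "\<theta> a * \<theta> b * triple a b x y z =
          (s a * 1) * triple a b x y z + (1 * s b) * triple a b x y z"
      proof (cases "b = Suc a \<or> a = Suc b")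
        case True
        then have "\<theta> a * \<theta> b = s a + s b" using s[of a] s[of b] by (auto simp: mult.commute add.commute)
        then show ?thesis by (simp add: distrib_right)
      next
        case False
        then show ?thesis using triple_zero ab by simp
      qed
    qed
    also have "\<dots> = (\<Sum>a\<le>D. \<Sum>b\<le>D. s a * 1 * triple a b x y z) +
        (\<Sum>a\<le>D. \<Sum>b\<le>D. 1 * s b * triple a b x y z)"
      by (simp only: sum.distrib)
    also have "\<dots> = (\<Sum>w\<in>UNIV. \<sigma> (d y w) * E 1 $ x $ w * (if w = z then 1 else 0)) +
        (\<Sum>w\<in>UNIV. (if y = w then 1 else 0) * E 1 $ x $ w * \<sigma> (d w z))"
      unfolding combination_triple[symmetric] \<sigma> by (simp add: E_sum)
    also have "\<dots> = \<sigma> (d y z) * (E 1 $ x $ y + E 1 $ x $ z)"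
      by (simp add: if_distrib[of "\<lambda>t. t * _"] if_distrib[of "\<lambda>t. _ * t"] distrib_left mult.commute cong: if_cong)
    finally show ?thesis .
  qed
  then show ?thesis by blast
qed

text \<open>
  Otherwise \<open>w\<close> is the only common neighbour of any two of its neighbours, and \<open>common_sum_E1\<close>
  expresses the column of $E_1$ at \<open>w\<close> by those at any two of them, always with the same factor.
\<close>

lemma two_common_neighbours:
  assumes valency: "\<And>x. 3 \<le> card {y. adj x y}"
    and uv: "d u v = 2"
  shows "2 \<le> card (common u v)"
proof (rule ccontr)
  assume less: "\<not> 2 \<le> card (common u v)"
  have single: "common y z = {w}" if "adj y w" "adj w z" "y \<noteq> z" for y z w
  proof -
    have "card (common y z) \<le> Suc 0"
      using less card_common_cong[of y z u v] dist_2I[OF that] uv by simp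
    then have "\<forall>a\<in>common y z. \<forall>b\<in>common y z. a = b" by (simp add: card_le_Suc0_iff_eq)
    moreover have "w \<in> common y z" using that by (simp add: common_def)
    ultimately show ?thesis by blast
  qed
  obtain \<sigma> where \<sigma>: "\<And>x y z. (\<Sum>w\<in>common y z. E 1 $ x $ w) = \<sigma> (d y z) * (E 1 $ x $ y + E 1 $ x $ z)"
    using common_sum_E1 by blast
  have mid: "E 1 $ x $ w = \<sigma> 2 * (E 1 $ x $ y + E 1 $ x $ z)"
    if "adj y w" "adj w z" "y \<noteq> z" for x y z w
    using \<sigma>[where x = x and y = y and z = z] by (simp add: single[OF that] dist_2I[OF that])
  obtain x0 w0 where nz: "E 1 $ x0 $ w0 \<noteq> 0" using E_nonzero[of 1] D_ge by auto
  obtain S where S: "S \<subseteq> {y. adj w0 y}" "card S = 3"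
    using obtain_subset_with_card_n[OF valency] by metis
  then obtain a b c where "S = {a, b, c}" "a \<noteq> b" "a \<noteq> c" "b \<noteq> c"
    by (auto simp: card_3_iff)
  with S have abc: "adj w0 a" "adj w0 b" "adj w0 c" "a \<noteq> b" "a \<noteq> c" "b \<noteq> c" by auto
  have eqs: "E 1 $ x $ w0 = \<sigma> 2 * (E 1 $ x $ a + E 1 $ x $ b)"
    "E 1 $ x $ w0 = \<sigma> 2 * (E 1 $ x $ a + E 1 $ x $ c)" for x
    using mid abc adj_sym by blast+
  have "\<sigma> 2 \<noteq> 0" using eqs(1)[of x0] nz by auto
  then have "E 1 $ x $ b = E 1 $ x $ c" for x
    using eqs[of x] by simp
  then show False using E1_separates_vertices abc by blast
qed

end

section \<open>The span of the profile vectors\<close>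

lemma card_profiles: "card (profiles D) = (D + 3) choose 3"
proof -
  have "bij_betw (\<lambda>(r, s, t, u). [r, s, t, u]) (profiles D) {l. length l = 4 \<and> sum_list l = D}"
    unfolding bij_betw_def profiles_def
  proof (intro conjI equalityI subsetI)
    fix l assume l: "l \<in> {l. length l = 4 \<and> sum_list l = D}"
    then obtain r s t u where "l = [r, s, t, u]"
      by (auto simp: length_Suc_conv numeral_eq_Suc)
    with l show "l \<in> (\<lambda>(r, s, t, u). [r, s, t, u]) ` {(r, s, t, u). r + s + t + u = D}"
      by (intro image_eqI[of _ _ "(r, s, t, u)"]) auto
  qed (auto simp: inj_on_def)
  then have "card (profiles D) = card {l::nat list. length l = 4 \<and> sum_list l = D}"
    by (rule bij_betw_same_card)
  also have "\<dots> = (D + 4 - 1) choose D" by (rule card_length_sum_list)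
  also have "D + 4 - 1 = D + 3" by simp
  also have "(D + 3) choose D = (D + 3) choose (D + 3 - D)"
    by (rule binomial_symmetric) simp
  also have "D + 3 - D = 3" by simp
  finally show ?thesis .
qed

lemma finite_profiles: "finite (profiles D)"
  by (rule finite_subset[of _ "{..D} \<times> {..D} \<times> {..D} \<times> {..D}"]) (auto simp: profiles_def)

lemma profile_vector_nth:
  "profile_vector adj p $ (x, y, z) = (if has_profile adj x y z p then 1 else 0)"
proof -
  have "(case t of (a, b, c) \<Rightarrow> tensor3 (axis a 1) (axis b 1) (axis c 1)) $ (x, y, z) =
      (if t = (x, y, z) then 1 else 0)" for t :: "'a \<times> 'a \<times> 'a"
    by (cases t) (simp add: tensor3_def axis_def)
  then show ?thesis
    by (simp add: profile_vector_def sum_component)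
qed

lemma profile_unique: "has_profile adj x y z p \<Longrightarrow> has_profile adj x y z p' \<Longrightarrow> p = p'"
  by (cases p; cases p') (auto simp: has_profile_def profiles_def)

text \<open>
  Each vector has a coordinate that is nonzero for it alone, which isolates its coefficient in a
  vanishing combination.
\<close>

lemma dim_span_private_coordinates:
  fixes f :: "'a \<Rightarrow> 'k::field ^ 'n"
  assumes fin: "finite S"
    and own: "\<And>p. p \<in> S \<Longrightarrow> \<exists>i. f p $ i \<noteq> 0 \<and> (\<forall>p'\<in>S. p' \<noteq> p \<longrightarrow> f p' $ i = 0)"
  shows "vec.dim (vec.span (f ` S)) = card S"
proof -
  have inj: "inj_on f S"
    using own unfolding inj_on_def by metis
  have "vec.independent (f ` S)"
  proof (rule vec.independent_if_scalars_zero)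
    fix c v assume 0: "(\<Sum>x\<in>f ` S. c x *s x) = 0" and "v \<in> f ` S"
    then obtain p where p: "p \<in> S" "v = f p" by blast
    obtain i where i: "f p $ i \<noteq> 0" "\<forall>p'\<in>S. p' \<noteq> p \<longrightarrow> f p' $ i = 0"
      using own[OF p(1)] by blast
    have "0 = (\<Sum>p'\<in>S. c (f p') *s f p') $ i"
      using 0 inj by (simp add: sum.reindex)
    also have "\<dots> = (\<Sum>p'\<in>S. if p' = p then c (f p) * f p $ i else 0)"
      using i(2) unfolding sum_component by (intro sum.cong) auto
    also have "\<dots> = c v * f p $ i" using fin p by simp
    finally show "c v = 0" using i(1) by simp
  qed (use fin in simp)
  then have "vec.dim (vec.span (f ` S)) = card (f ` S)"
    by (rule vec.dim_span_eq_card_independent)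
  with inj show ?thesis by (simp add: card_image)
qed

lemma dim_Lambda_space:
  assumes real: "\<And>p. p \<in> profiles (diam adj) \<Longrightarrow> \<exists>x y z. has_profile adj x y z p"
  shows "vec.dim (Lambda_space adj) = (diam adj + 3) choose 3"
proof -
  have "vec.dim (Lambda_space adj) = card (profiles (diam adj))"
    unfolding Lambda_space_def
  proof (rule dim_span_private_coordinates[OF finite_profiles])
    fix p assume "p \<in> profiles (diam adj)"
    then obtain x y z where xyz: "has_profile adj x y z p" using real by blast
    then have "\<not> has_profile adj x y z p'" if "p' \<noteq> p" for p'
      using profile_unique that by metis
    with xyz show "\<exists>i. profile_vector adj p $ i \<noteq> 0 \<and>
        (\<forall>p'\<in>profiles (diam adj). p' \<noteq> p \<longrightarrow> profile_vector adj p' $ i = 0)"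
      by (intro exI[of _ "(x, y, z)"]) (simp add: profile_vector_nth)
  qed
  then show ?thesis by (simp only: card_profiles)
qed

section \<open>Dimension of the space\<close>

theorem lemma8p14:
  fixes adj :: "'v::finite \<Rightarrow> 'v \<Rightarrow> bool"
  assumes "two_homogeneous_bipartite adj"
    and "diam adj \<ge> 3"
    and "\<not> is_hypercube adj"
    and "\<not> is_cycle adj"
  shows "vec.dim (Lambda_space adj) = (diam adj + 3) choose 3"
proof -
  have parts: "distance_regular adj" "bipartite adj" "antipodal_2_cover adj" "q_polynomial adj"
    using assms(1) by (simp_all add: two_homogeneous_bipartite_def)
  interpret antipodal_bipartite_drg adj
    using parts assms(2) by unfold_locales (auto simp: distance_regular_def)
  obtain E where "q_polynomial_ordering adj E"
    using parts(4) by (auto simp: q_polynomial_def)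
  then obtain q where q: "primitive_idempotents adj E" "krein_parameters adj E q"
    "\<forall>h\<le>D. \<forall>i\<le>D. \<forall>j\<le>D. (h > i + j \<or> i > h + j \<or> j > h + i \<longrightarrow> q h i j = 0) \<and>
      (h = i + j \<or> i = h + j \<or> j = h + i \<longrightarrow> q h i j \<noteq> 0)"
    unfolding q_polynomial_ordering_def by blast
  interpret q_polynomial_drg adj E q
    using q by unfold_locales auto
  have valency: "3 \<le> card {y. adj x y}" for x
  proof (rule ccontr)
    assume "\<not> 3 \<le> card {y. adj x y}"
    then have "card {y. adj x y} = 2" using valency_ge_2[of x] by simp
    then have "card {y. adj z y} = 2" for z using card_neighbours_cong[of z x] by simp
    then show False using cycle_if_2_regular assms(4) by blast
  qed
  have quad: "2 \<le> card (common u v)" if "d u v = 2" for u v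
    using two_common_neighbours[OF valency that] .
  show ?thesis
  proof (rule dim_Lambda_space)
    fix p assume "p \<in> profiles D"
    then obtain r s t u where p: "p = (r, s, t, u)" "r + s + t + u = D"
      by (auto simp: profiles_def)
    then obtain x y z where "d x y = s + t" "d y z = t + u" "d x z = u + s"
      using profile_realised[OF quad] by blast
    then have "has_profile adj x y z p"
      using p by (simp add: has_profile_def profiles_def dist_sym[of z x])
    then show "\<exists>x y z. has_profile adj x y z p" by blast
  qed
qed

end
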